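(* Let $g\in\mathbb{Z}^+$. There is a constant $K$ depending only on $d,m,n,g$ such that: if $\mathcal{H}_0=\mathcal{B}^0$ and $\mathcal{H}_{r+1}$ is an output of $\mathrm{GARefine}(\mathcal{H}_r,\mathcal{M}_r)$ with $\mathcal{M}_r\subset\mathcal{H}_r$ for $r=0,1,\dots$, then for every $R\ge1$ $$\#\mathcal{H}_R-\#\mathcal{H}_0\le K\sum_{r=0}^{R-1}\#\mathcal{M}_r.$$
   Context: Fix integers $d\ge1$, $n\ge2$, $m\ge2$; $s=n-1$, $p=m-1$. B-splines $\varphi^\ell_{\vec i}(\vec x)=\prod_kQ(n^\ell x_k-i_k)$ for $\ell\ge0$, $\vec i\in\mathbb{Z}^d$, $Q$ the uniform B-spline of order $m$ with knots $0,\dots,m$; $\mathfrak{B}$ the set of all of them; $\mathcal{B}^0=\{\varphi^0_{\vec i}:\vec i\in[-p:0]^d\}$. Children $\mathrm{ch}(\varphi^\ell_{\vec i})=\{\varphi^{\ell+1}_{\vec k}:n\vec i\le\vec k\le n\vec i+sm\}$, extended to sets by union. Cells $I^\ell_{\vec i}=\prod_k[i_kn^{-\ell},(i_k+1)n^{-\ell})$, cell children $\mathrm{ch}(I^\ell_{\vec i})=\{I^{\ell+1}_{\vec k}:n\vec i\le\vec k\le n\vec i+s\}$, $\mathrm{ch}^k$ iterated, $\mathrm{ch}^{-k}(I)=\{J:I\in\mathrm{ch}^k(J)\}$. $\mathbb{I}(\varphi^\ell_{\vec i})=\{I^\ell_{\vec k}:\vec i\le\vec k\le\vec i+p\}$,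 $\mathbb{I}^k(\varphi)=\mathrm{ch}^k(\mathbb{I}(\varphi))$ ($k\in\mathbb{Z}$), $\mathbb{B}^k(I)=\{\varphi\in\mathfrak{B}:I\in\mathbb{I}^{-k}(\varphi)\}$, extended to sets by union; $\mathcal{O}(\varphi,j,\mathcal{H})=\mathbb{B}^j(\mathbb{I}(\varphi))\cap\mathcal{H}$. A lineage is a finite $\mathcal{L}\subset\mathfrak{B}$ with $\mathcal{L}\subset\mathcal{B}^0\cup\mathrm{ch}(\mathcal{L})$; its hierarchical generator is $(\mathcal{B}^0\cup\mathrm{ch}(\mathcal{L}))\setminus\mathcal{L}$ (the lineage is determined by the generator; $\mathcal{B}^0$ has lineage $\emptyset$). $\mathcal{H}$ is absorbing if no $\varphi\in\mathcal{H}$ has $\mathbb{I}(\varphi)\subset\mathbb{I}(\mathcal{L})$. $\mathrm{gap}_{\mathcal{H}}(\varphi)=\sup\{g\in\mathbb{Z}:\mathcal{O}(\varphi,-g,\mathcal{H})\neq\emptyset\}$, $\mathrm{gap}(\mathcal{H})=\max_{\varphi\in\mathcal{H}}\mathrm{gap}_{\mathcal{H}}(\varphi)$. For a generator $\mathcal{H}'$ with lineage $\mathcal{L}'$, $\mathrm{gap}(\mathcal{H}')\le g$ and $\varphi\in\mathcal{H}'$, let $\mathrm{GC}(\mathcal{H}',\varphi)$ be the least (w.r.t. inclusion of lineages) hierarchical generator whose lineage contains $\mathcal{L}'\cup\{\varphi\}$ and whose gap is $\le g$ (it exists). For an absorbing $\mathcal{H}$ with gap $\le g$ and $\mathcal{M}\subset\mathcal{H}$,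 $\mathrm{GARefine}(\mathcal{H},\mathcal{M})$: start with $\mathcal{H}'=\mathcal{H}$; while $\mathcal{M}\cap\mathcal{H}'\neq\emptyset$, choose any $\varphi\in\mathcal{M}\cap\mathcal{H}'$ and replace $\mathcal{H}'$ by $\mathrm{GC}(\mathcal{H}',\varphi)$; then output the least absorbing hierarchical generator whose lineage contains the lineage of the final $\mathcal{H}'$ (it exists; the output is again absorbing with gap $\le g$). Any choice order gives an admissible output. *)

theory Defs
  imports Complex_Main
begin

(* A B-spline phi^l_i (resp. a cell I^l_i) is represented by its level/index pair (l, i),
   with the multi-index i in Z^d represented as an int list of length d.
   The map (l,i) |-> phi^l_i is injective, so this identification is faithful. *)
type_synonym idx = "nat \<times> int list"

definition box :: "int list \<Rightarrow> int list \<Rightarrow> int list set" where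
  "box lo hi = {k. list_all2 (\<le>) lo k \<and> list_all2 (\<le>) k hi}"

definition allB :: "nat \<Rightarrow> idx set" where
  "allB d = {(l, i). length i = d}"

(* \<B>^0 = {phi^0_i : i \<in> [-p:0]^d}, p = m - 1 *)
definition B0 :: "nat \<Rightarrow> nat \<Rightarrow> idx set" where
  "B0 d m = {(0, i) | i. i \<in> box (replicate d (1 - int m)) (replicate d 0)}"

definition bch :: "nat \<Rightarrow> nat \<Rightarrow> idx \<Rightarrow> idx set" where
  "bch n m phi = (case phi of (l, i) \<Rightarrow>
     {(Suc l, k) | k. k \<in> box (map (\<lambda>x. int n * x) i)
                                 (map (\<lambda>x. int n * x + (int n - 1) * int m) i)})"

definition bchs :: "nat \<Rightarrow> nat \<Rightarrow> idx set \<Rightarrow> idx set" where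
  "bchs n m S = \<Union> (bch n m ` S)"

definition cch :: "nat \<Rightarrow> idx \<Rightarrow> idx set" where
  "cch n I = (case I of (l, i) \<Rightarrow>
     {(Suc l, k) | k. k \<in> box (map (\<lambda>x. int n * x) i)
                                 (map (\<lambda>x. int n * x + (int n - 1)) i)})"

definition cchs :: "nat \<Rightarrow> idx set \<Rightarrow> idx set" where
  "cchs n S = \<Union> (cch n ` S)"

definition cch_pow :: "nat \<Rightarrow> int \<Rightarrow> idx set \<Rightarrow> idx set" where
  "cch_pow n k S = (if 0 \<le> k then (cchs n ^^ nat k) S
                    else {J. \<exists>I\<in>S. I \<in> (cchs n ^^ nat (- k)) {J}})"

definition supp_cells :: "nat \<Rightarrow> idx \<Rightarrow> idx set" where
  "supp_cells m phi = (case phi of (l, i) \<Rightarrow>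
     {(l, k) | k. k \<in> box i (map (\<lambda>x. x + (int m - 1)) i)})"

definition II :: "nat \<Rightarrow> nat \<Rightarrow> int \<Rightarrow> idx \<Rightarrow> idx set" where
  "II n m k phi = cch_pow n k (supp_cells m phi)"

definition BB :: "nat \<Rightarrow> nat \<Rightarrow> nat \<Rightarrow> int \<Rightarrow> idx set \<Rightarrow> idx set" where
  "BB d n m k S = {psi \<in> allB d. \<exists>I\<in>S. I \<in> II n m (- k) psi}"

definition Oset :: "nat \<Rightarrow> nat \<Rightarrow> nat \<Rightarrow> idx \<Rightarrow> int \<Rightarrow> idx set \<Rightarrow> idx set" where
  "Oset d n m phi j H = BB d n m j (supp_cells m phi) \<inter> H"

definition gapB :: "nat \<Rightarrow> nat \<Rightarrow> nat \<Rightarrow> idx set \<Rightarrow> idx \<Rightarrow> int" where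
  "gapB d n m H phi = Sup {g. Oset d n m phi (- g) H \<noteq> {}}"

definition gapH :: "nat \<Rightarrow> nat \<Rightarrow> nat \<Rightarrow> idx set \<Rightarrow> int" where
  "gapH d n m H = Max (gapB d n m H ` H)"

definition lineage :: "nat \<Rightarrow> nat \<Rightarrow> nat \<Rightarrow> idx set \<Rightarrow> bool" where
  "lineage d n m L \<longleftrightarrow> finite L \<and> L \<subseteq> allB d \<and> L \<subseteq> B0 d m \<union> bchs n m L"

definition gen :: "nat \<Rightarrow> nat \<Rightarrow> nat \<Rightarrow> idx set \<Rightarrow> idx set" where
  "gen d n m L = (B0 d m \<union> bchs n m L) - L"

definition absorbing :: "nat \<Rightarrow> nat \<Rightarrow> nat \<Rightarrow> idx set \<Rightarrow> bool" where
  "absorbing d n m L \<longleftrightarrow>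
     (\<forall>phi \<in> gen d n m L. \<not> supp_cells m phi \<subseteq> (\<Union>psi\<in>L. supp_cells m psi))"

(* L2 is the lineage of GC(gen L, phi): least lineage containing L \<union> {phi}
   whose generator has gap \<le> g *)
definition GC_rel :: "nat \<Rightarrow> nat \<Rightarrow> nat \<Rightarrow> int \<Rightarrow> idx set \<Rightarrow> idx \<Rightarrow> idx set \<Rightarrow> bool" where
  "GC_rel d n m g L phi L2 \<longleftrightarrow>
     lineage d n m L2 \<and> insert phi L \<subseteq> L2 \<and> gapH d n m (gen d n m L2) \<le> g \<and>
     (\<forall>L3. lineage d n m L3 \<and> insert phi L \<subseteq> L3 \<and> gapH d n m (gen d n m L3) \<le> g
           \<longrightarrow> L2 \<subseteq> L3)"

definition abs_rel :: "nat \<Rightarrow> nat \<Rightarrow> nat \<Rightarrow> idx set \<Rightarrow> idx set \<Rightarrow> bool" where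
  "abs_rel d n m L L2 \<longleftrightarrow>
     lineage d n m L2 \<and> L \<subseteq> L2 \<and> absorbing d n m L2 \<and>
     (\<forall>L3. lineage d n m L3 \<and> L \<subseteq> L3 \<and> absorbing d n m L3 \<longrightarrow> L2 \<subseteq> L3)"

(* the while loop of GARefine, on lineages, with arbitrary choice of phi *)
inductive ga_loop :: "nat \<Rightarrow> nat \<Rightarrow> nat \<Rightarrow> int \<Rightarrow> idx set \<Rightarrow> idx set \<Rightarrow> idx set \<Rightarrow> bool"
  for d n m :: nat and g :: int and M :: "idx set" where
  stop: "M \<inter> gen d n m L = {} \<Longrightarrow> ga_loop d n m g M L L"
| step: "phi \<in> M \<inter> gen d n m L \<Longrightarrow> GC_rel d n m g L phi L2 \<Longrightarrow> ga_loop d n m g M L2 Lf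
         \<Longrightarrow> ga_loop d n m g M L Lf"

definition garefine :: "nat \<Rightarrow> nat \<Rightarrow> nat \<Rightarrow> int \<Rightarrow> idx set \<Rightarrow> idx set \<Rightarrow> idx set \<Rightarrow> bool" where
  "garefine d n m g H M Hout \<longleftrightarrow>
     (\<exists>L Lf Lout. lineage d n m L \<and> gen d n m L = H \<and> ga_loop d n m g M L Lf \<and>
                  abs_rel d n m Lf Lout \<and> Hout = gen d n m Lout)"

end

theory Submission
  imports Defs
begin

text \<open>
A lineage has gap at most \<open>g\<close> iff it is closed under the rule: if \<open>x\<close> belongs to it and \<open>y\<close> is a
descendant of \<open>\<B>\<^sup>0\<close> exactly \<open>g\<close> levels coarser whose support meets that of \<open>x\<close>, then \<open>y\<close> belongs
to it. Hence \<open>GC\<close> of a marked \<open>x\<close> only adds B-splines of level \<open>l\<close> at most that of \<open>x\<close> and within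
distance \<open>O(n\<^sup>-\<^sup>l)\<close> of \<open>x\<close>, while absorption does not change the set of cells covered by the lineage.
So every cell \<open>c\<close> covered by the lineage is near a marked B-spline at least as fine as \<open>c\<close>, and every
marked B-spline of positive level is near an earlier marked one that is at most one level coarser.
As in the argument of Binev, Dahmen and DeVore, every \<open>x\<close> in the lineage then receives weight at least 1
from the marked B-splines \<open>y\<close> of level \<open>k \<ge> l\<close> within distance \<open>O(n\<^sup>-\<^sup>l)\<close> of \<open>x\<close>, where \<open>l\<close> is the
level of \<open>x\<close> and \<open>y\<close> contributes \<open>n\<^sup>-\<^sup>(\<^sup>k\<^sup>-\<^sup>l\<^sup>)\<close>; conversely each \<open>y\<close> hands out bounded total weight.
\<close>

section \<open>Boxes, supports and descendants\<close>

lemma mem_box_iff: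
  "k \<in> box lo hi \<longleftrightarrow> length lo = length k \<and> length hi = length k \<and>
     (\<forall>j<length k. lo ! j \<le> k ! j \<and> k ! j \<le> hi ! j)"
  by (auto simp: box_def list_all2_conv_all_nth)

lemma mem_supp_cells_iff:
  "c \<in> supp_cells m x \<longleftrightarrow> fst c = fst x \<and> length (snd c) = length (snd x) \<and>
     (\<forall>j<length (snd x). snd x ! j \<le> snd c ! j \<and> snd c ! j \<le> snd x ! j + (int m - 1))"
  by (cases c; cases x) (auto simp: supp_cells_def mem_box_iff)

lemma mem_bch_iff:
  "y \<in> bch n m x \<longleftrightarrow> fst y = Suc (fst x) \<and> length (snd y) = length (snd x) \<and>
     (\<forall>j<length (snd x). int n * snd x ! j \<le> snd y ! j \<and>
        snd y ! j \<le> int n * snd x ! j + (int n - 1) * int m)"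
  by (cases y; cases x) (auto simp: bch_def mem_box_iff)

lemma mem_bchs_iff: "y \<in> bchs n m S \<longleftrightarrow> (\<exists>x\<in>S. y \<in> bch n m x)"
  by (auto simp: bchs_def)

lemma bchs_mono: "S \<subseteq> S' \<Longrightarrow> bchs n m S \<subseteq> bchs n m S'"
  by (auto simp: bchs_def)

lemma mem_B0_iff:
  "x \<in> B0 d m \<longleftrightarrow> fst x = 0 \<and> length (snd x) = d \<and>
     (\<forall>j<d. 1 - int m \<le> snd x ! j \<and> snd x ! j \<le> 0)"
  by (cases x) (auto simp: B0_def mem_box_iff)

section \<open>Counting indices of a fixed level\<close>

lemma card_lists_nth_shift:
  fixes f :: "nat \<Rightarrow> int"
  assumes "finite S"
  shows "finite {k. length k = d \<and> (\<forall>j<d. k ! j - f j \<in> S)}"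
    and "card {k. length k = d \<and> (\<forall>j<d. k ! j - f j \<in> S)} \<le> card S ^ d"
proof -
  let ?A = "{k. length k = d \<and> (\<forall>j<d. k ! j - f j \<in> S)}"
  let ?B = "{ys. set ys \<subseteq> S \<and> length ys = d}"
  let ?h = "\<lambda>k. map (\<lambda>j. k ! j - f j) [0..<d]"
  have inj: "inj_on ?h ?A"
    by (auto simp: inj_on_def intro!: nth_equalityI)
  have sub: "?h ` ?A \<subseteq> ?B"
    by auto
  have fin: "finite ?B"
    using finite_lists_length_eq[OF assms, of d] by simp
  show "finite ?A"
    using inj_on_finite[OF inj sub fin] .
  show "card ?A \<le> card S ^ d"
    using card_inj_on_le[OF inj sub fin] card_lists_length_eq[OF assms, of d] by simp
qed

lemma finite_card_levelset:
  fixes f :: "nat \<Rightarrow> int"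
  assumes "finite S" and sub: "\<And>x. x \<in> X \<Longrightarrow> fst x = l \<and> length (snd x) = d \<and> (\<forall>j<d. snd x ! j - f j \<in> S)"
  shows "finite X" and "card X \<le> card S ^ d"
proof -
  let ?A = "{k. length k = d \<and> (\<forall>j<d. k ! j - f j \<in> S)}"
  have inj: "inj_on snd X"
    using sub by (auto simp: inj_on_def prod_eq_iff)
  have im: "snd ` X \<subseteq> ?A"
    using sub by auto
  note A = card_lists_nth_shift[OF \<open>finite S\<close>, of d f]
  show "finite X"
    using inj_on_finite[OF inj im A(1)] .
  show "card X \<le> card S ^ d"
    using card_inj_on_le[OF inj im A(1)] A(2) by simp
qed

lemma finite_B0: "finite (B0 d m)"
  by (rule finite_card_levelset(1)[where S = "{1 - int m..0}" and f = "\<lambda>_. 0" and l = 0 and d = d])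
     (auto simp: mem_B0_iff)

lemma finite_bch: "finite (bch n m x)"
  and card_bch_le: "n \<ge> 1 \<Longrightarrow> card (bch n m x) \<le> (n * m + 1) ^ length (snd x)"
proof -
  have *: "fst y = Suc (fst x) \<and> length (snd y) = length (snd x) \<and>
      (\<forall>j<length (snd x). snd y ! j - int n * snd x ! j \<in> {0..(int n - 1) * int m})"
    if "y \<in> bch n m x" for y
    using that by (auto simp: mem_bch_iff algebra_simps)
  note B = finite_card_levelset[OF _ *, of "bch n m x"]
  show "finite (bch n m x)"
    by (rule B) auto
  assume "n \<ge> 1"
  have "card (bch n m x) \<le> card {0..(int n - 1) * int m} ^ length (snd x)"
    by (rule B) auto
  also have "\<dots> \<le> (n * m + 1) ^ length (snd x)"
    using \<open>n \<ge> 1\<close> by (intro power_mono) (auto simp: algebra_simps nat_le_iff)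
  finally show "card (bch n m x) \<le> (n * m + 1) ^ length (snd x)" .
qed

lemma finite_gen: "finite L \<Longrightarrow> finite (gen d n m L)"
  by (simp add: gen_def bchs_def finite_B0 finite_bch)

lemma supp_cells_self: "m \<ge> 1 \<Longrightarrow> x \<in> supp_cells m x"
  by (simp add: mem_supp_cells_iff)

lemma finite_supp_cells: "finite (supp_cells m x)"
  by (rule finite_card_levelset(1)[where S = "{0..int m - 1}" and f = "\<lambda>j. snd x ! j"
        and l = "fst x" and d = "length (snd x)"])
     (auto simp: mem_supp_cells_iff)

text \<open>Every lineage and its generator lie in this set. The closure conditions below are
  restricted to it, since no lineage can contain anything else.\<close>

inductive_set desc :: "nat \<Rightarrow> nat \<Rightarrow> nat \<Rightarrow> idx set" for d n m where
  root: "x \<in> B0 d m \<Longrightarrow> x \<in> desc d n m"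
| child: "x \<in> desc d n m \<Longrightarrow> y \<in> bch n m x \<Longrightarrow> y \<in> desc d n m"

lemma desc_length: "x \<in> desc d n m \<Longrightarrow> length (snd x) = d"
  by (induction rule: desc.induct) (auto simp: mem_B0_iff mem_bch_iff)

lemma lineage_subset_desc:
  assumes "lineage d n m L"
  shows "L \<subseteq> desc d n m"
proof
  fix x assume "x \<in> L"
  then show "x \<in> desc d n m"
  proof (induction "fst x" arbitrary: x)
    case 0
    then show ?case
      using assms by (auto simp: lineage_def mem_bchs_iff mem_bch_iff intro: desc.root)
  next
    case (Suc l)
    then have "x \<in> B0 d m \<or> (\<exists>y\<in>L. x \<in> bch n m y)"
      using assms by (auto simp: lineage_def mem_bchs_iff)
    then show ?case
    proof
      assume "\<exists>y\<in>L. x \<in> bch n m y"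
      then obtain y where "y \<in> L" "x \<in> bch n m y" by blast
      moreover from this have "y \<in> desc d n m"
        using Suc.hyps by (auto simp: mem_bch_iff)
      ultimately show ?thesis
        by (blast intro: desc.child)
    qed (rule desc.root)
  qed
qed

lemma gen_subset_desc: "lineage d n m L \<Longrightarrow> gen d n m L \<subseteq> desc d n m"
  using lineage_subset_desc[of d n m L] unfolding gen_def mem_bchs_iff bchs_def
  by (blast intro: desc.intros)

text \<open>Induction on the level: a parent of \<open>x\<close> passes to \<open>L'\<close>, so
  \<open>x\<close> lies in \<open>gen d n m L'\<close> or in \<open>L'\<close>; the former equals
  \<open>gen d n m L\<close>, which excludes \<open>x\<close>.\<close>

lemma gen_subset_le:
  assumes "lineage d n m L" "lineage d n m L'" "gen d n m L = gen d n m L'"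
  shows "L \<subseteq> L'"
proof
  fix x assume "x \<in> L"
  then show "x \<in> L'"
  proof (induction "fst x" arbitrary: x rule: less_induct)
    case less
    have "x \<in> B0 d m \<or> (\<exists>y\<in>L. x \<in> bch n m y)"
      using less.prems assms by (auto simp: lineage_def mem_bchs_iff)
    then have "x \<in> B0 d m \<or> (\<exists>y\<in>L'. x \<in> bch n m y)"
      using less.hyps by (fastforce simp: mem_bch_iff)
    then have "x \<in> gen d n m L' \<or> x \<in> L'"
      by (auto simp: gen_def mem_bchs_iff)
    then show ?case
      using less.prems assms(3) by (auto simp: gen_def)
  qed
qed

lemma lineage_eqI:
  "lineage d n m L \<Longrightarrow> lineage d n m L' \<Longrightarrow> gen d n m L = gen d n m L' \<Longrightarrow> L = L'"
  by (simp add: gen_subset_le subset_antisym)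


section \<open>Cells covered by a B-spline\<close>

text \<open>The \<open>div\<close> yields the ancestor of \<open>c\<close> at the level of
  \<open>x\<close>. For \<open>n \<ge> 1\<close> this is membership of \<open>c\<close> in
  \<open>II n m k x\<close>, with \<open>k\<close> the level difference, free of iterated
  children.\<close>

definition covers :: "nat \<Rightarrow> nat \<Rightarrow> idx \<Rightarrow> idx \<Rightarrow> bool" where
  "covers n m x c \<longleftrightarrow> fst x \<le> fst c \<and>
     (fst x, map (\<lambda>t. t div int n ^ (fst c - fst x)) (snd c)) \<in> supp_cells m x"

lemma covers_iff:
  "covers n m x c \<longleftrightarrow> fst x \<le> fst c \<and> length (snd c) = length (snd x) \<and>
     (\<forall>j<length (snd x). snd x ! j \<le> snd c ! j div int n ^ (fst c - fst x) \<and>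
        snd c ! j div int n ^ (fst c - fst x) \<le> snd x ! j + (int m - 1))"
  by (auto simp: covers_def mem_supp_cells_iff)

lemma covers_supp_cells: "c \<in> supp_cells m x \<Longrightarrow> covers n m x c"
  by (auto simp: covers_iff mem_supp_cells_iff)

lemma le_zdiv_iff:
  fixes a t k :: int
  assumes k: "0 < k"
  shows "a \<le> t div k \<longleftrightarrow> a * k \<le> t"
proof -
  have "a * k \<le> t" if "a \<le> t div k"
    using mult_right_mono[OF that, of k] minus_mod_eq_div_mult[of t k] pos_mod_sign[OF k, of t] k by linarith
  moreover have "a \<le> t div k" if "a * k \<le> t"
    using zdiv_mono1[OF that k] k by simp
  ultimately show ?thesis by blast
qed

lemma zdiv_less_iff: "0 < k \<Longrightarrow> t div k < b \<longleftrightarrow> t < b * k" for b t k :: int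
  by (meson le_zdiv_iff not_less)

text \<open>In units of the finer level, the support of a child ends at most at
  \<open>n * i + (n - 1) * m + m = n * (i + m)\<close>, where that of its parent ends.\<close>

lemma covers_parent:
  assumes "n \<ge> 1" "y \<in> bch n m x" "covers n m y c"
  shows "covers n m x c"
proof -
  have y: "fst y = Suc (fst x)" "length (snd y) = length (snd x)"
    using assms(2) by (auto simp: mem_bch_iff)
  have "snd x ! j \<le> snd c ! j div int n ^ (fst c - fst x) \<and>
        snd c ! j div int n ^ (fst c - fst x) \<le> snd x ! j + (int m - 1)"
    if j: "j < length (snd x)" for j
  proof -
    let ?t = "snd c ! j div int n ^ (fst c - fst y)"
    have "fst c - fst x = Suc (fst c - fst y)"
      using assms(3) y by (auto simp: covers_iff)
    then have e: "snd c ! j div int n ^ (fst c - fst x) = ?t div int n"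
      by (simp add: zdiv_zmult2_eq power_Suc2 del: power_Suc)
    have b: "snd y ! j \<le> ?t" "?t \<le> snd y ! j + (int m - 1)"
      using assms(3) j y by (auto simp: covers_iff)
    have c: "int n * snd x ! j \<le> snd y ! j" "snd y ! j \<le> int n * snd x ! j + (int n - 1) * int m"
      using assms(2) j by (auto simp: mem_bch_iff)
    have "snd x ! j * int n \<le> ?t" "?t < (snd x ! j + int m) * int n"
      using b c by (simp_all add: algebra_simps)
    then show ?thesis
      unfolding e using \<open>n \<ge> 1\<close> le_zdiv_iff[of "int n" "snd x ! j" ?t]
        zdiv_less_iff[of "int n" ?t "snd x ! j + int m"] by linarith
  qed
  then show ?thesis
    using assms(3) y by (auto simp: covers_iff)
qed

lemma covers_child:
  assumes "n \<ge> 1" "m \<ge> 1" "covers n m x c" "fst x < fst c"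
  obtains y where "y \<in> bch n m x" "covers n m y c"
proof -
  let ?t = "\<lambda>j. snd c ! j div int n ^ (fst c - Suc (fst x))"
  \<comment> \<open>The index of the cell at the child level, cut off at the last child. If the cut
    applies, the bound \<open>?t j < (snd x ! j + int m) * int n\<close> leaves a difference of less
    than \<open>m\<close>.\<close>
  let ?k = "\<lambda>j. min (?t j) (int n * snd x ! j + (int n - 1) * int m)"
  define y where "y = (Suc (fst x), map ?k [0..<length (snd x)])"
  have t: "snd x ! j * int n \<le> ?t j \<and> ?t j < (snd x ! j + int m) * int n"
    if j: "j < length (snd x)" for j
  proof -
    have "fst c - fst x = Suc (fst c - Suc (fst x))"
      using assms(4) by auto
    then have e: "snd c ! j div int n ^ (fst c - fst x) = ?t j div int n"
      by (simp add: zdiv_zmult2_eq power_Suc2 del: power_Suc)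
    show ?thesis
      using assms(3) j \<open>n \<ge> 1\<close> le_zdiv_iff[of "int n" "snd x ! j" "?t j"]
        zdiv_less_iff[of "int n" "?t j" "snd x ! j + int m"]
      unfolding covers_iff e[symmetric] by force
  qed
  have "int n * snd x ! j \<le> int n * snd x ! j + (int n - 1) * int m" for j
    using \<open>n \<ge> 1\<close> by simp
  then have "y \<in> bch n m x"
    using t by (auto simp: mem_bch_iff y_def mult.commute)
  moreover have "covers n m y c"
    using assms t by (fastforce simp: covers_iff y_def algebra_simps min_def)
  ultimately show ?thesis
    by (rule that)
qed

lemma covers_coarsen:
  assumes "fst x \<le> l" "l \<le> fst c"
  shows "covers n m x (l, map (\<lambda>t. t div int n ^ (fst c - l)) (snd c)) \<longleftrightarrow> covers n m x c"
proof -
  have "t div int n ^ (fst c - l) div int n ^ (l - fst x) = t div int n ^ (fst c - fst x)" for t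
    using assms by (simp add: zdiv_zmult2_eq[symmetric] power_add[symmetric])
  then show ?thesis
    using assms by (auto simp: covers_iff)
qed

text \<open>Coverings persist under passing to finer cells, so an overlap can be witnessed by a cell finer
  than the whole lineage; this is what lets \<open>ex_finer_gen\<close> descend inside a finite lineage.\<close>
lemma covers_refine:
  assumes "n \<ge> 1"
  shows "\<exists>c'. fst c' \<ge> l \<and> (\<forall>x. covers n m x c \<longrightarrow> covers n m x c')"
proof -
  let ?c = "(fst c + l, map (\<lambda>t. t * int n ^ l) (snd c))"
  have "covers n m x ?c" if "covers n m x c" for x
    using covers_coarsen[of x "fst c" ?c n m] that assms by (auto simp: covers_iff comp_def)
  then show ?thesis
    by (intro exI[of _ ?c]) auto
qed

section \<open>Iterated cell children and overlapping supports\<close>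

lemma mem_cchs_iff:
  assumes "n \<ge> 1"
  shows "c \<in> cchs n S \<longleftrightarrow>
    (\<exists>b\<in>S. fst c = Suc (fst b) \<and> snd b = map (\<lambda>t. t div int n) (snd c))"
proof -
  have *: "int n * a \<le> t \<and> t \<le> int n * a + (int n - 1) \<longleftrightarrow> a = t div int n" for a t
    using le_zdiv_iff[of "int n" a t] zdiv_less_iff[of "int n" t "a + 1"] assms
    by (auto simp: algebra_simps)
  have "c \<in> cch n b \<longleftrightarrow> fst c = Suc (fst b) \<and> snd c \<in> box (map ((*) (int n)) (snd b))
      (map (\<lambda>x. int n * x + (int n - 1)) (snd b))" for b
    by (cases b; cases c) (auto simp: cch_def)
  then have "c \<in> cch n b \<longleftrightarrow> fst c = Suc (fst b) \<and> snd b = map (\<lambda>t. t div int n) (snd c)" for b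
    by (auto simp: mem_box_iff list_eq_iff_nth_eq simp flip: *)
  then show ?thesis
    by (auto simp: cchs_def)
qed

lemma mem_cchs_pow_iff:
  assumes "n \<ge> 1"
  shows "c \<in> (cchs n ^^ h) S \<longleftrightarrow>
    (\<exists>b\<in>S. fst c = fst b + h \<and> snd b = map (\<lambda>t. t div int n ^ h) (snd c))"
proof (induction h arbitrary: c)
  case 0
  then show ?case by (auto simp: prod_eq_iff)
next
  case (Suc h)
  show ?case
    unfolding funpow.simps comp_def mem_cchs_iff[OF assms]
  proof
    assume "\<exists>b\<in>(cchs n ^^ h) S. fst c = Suc (fst b) \<and> snd b = map (\<lambda>t. t div int n) (snd c)"
    then obtain b a where "a \<in> S" "fst b = fst a + h" "snd a = map (\<lambda>t. t div int n ^ h) (snd b)"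
      "fst c = Suc (fst b)" "snd b = map (\<lambda>t. t div int n) (snd c)"
      unfolding Bex_def Suc by metis
    then show "\<exists>b\<in>S. fst c = fst b + Suc h \<and> snd b = map (\<lambda>t. t div int n ^ Suc h) (snd c)"
      by (intro bexI[of _ a]) (auto simp: comp_def zdiv_zmult2_eq)
  next
    assume "\<exists>b\<in>S. fst c = fst b + Suc h \<and> snd b = map (\<lambda>t. t div int n ^ Suc h) (snd c)"
    then obtain b where "b \<in> S" "fst c = fst b + Suc h" "snd b = map (\<lambda>t. t div int n ^ Suc h) (snd c)"
      by blast
    then show "\<exists>b\<in>(cchs n ^^ h) S. fst c = Suc (fst b) \<and> snd b = map (\<lambda>t. t div int n) (snd c)"
      by (intro bexI[of _ "(fst c - 1, map (\<lambda>t. t div int n) (snd c))"])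
         (auto simp: Suc comp_def zdiv_zmult2_eq intro!: bexI[of _ b])
  qed
qed

text \<open>A cell covered by both can be coarsened to the level of \<open>x\<close>. The sets
  \<open>Oset\<close> thereby reduce to a symmetric overlap relation and a level difference.\<close>

lemma supp_cells_cchs_pow_iff:
  assumes "n \<ge> 1"
  shows "(\<exists>c\<in>supp_cells m x. c \<in> (cchs n ^^ h) (supp_cells m y)) \<longleftrightarrow>
    fst x = fst y + h \<and> (\<exists>c. covers n m x c \<and> covers n m y c)"
proof
  assume "\<exists>c\<in>supp_cells m x. c \<in> (cchs n ^^ h) (supp_cells m y)"
  then obtain c b where c: "c \<in> supp_cells m x" and b: "b \<in> supp_cells m y"
    "fst c = fst b + h" "snd b = map (\<lambda>t. t div int n ^ h) (snd c)"
    unfolding mem_cchs_pow_iff[OF assms] by blast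
  moreover have "fst b = fst y" "fst c = fst x"
    using b c by (auto simp: mem_supp_cells_iff)
  ultimately have "covers n m y c"
    unfolding covers_def by (metis add_diff_cancel_left' le_add1 prod.collapse)
  then show "fst x = fst y + h \<and> (\<exists>c. covers n m x c \<and> covers n m y c)"
    using covers_supp_cells[OF c] b(2) \<open>fst b = fst y\<close> \<open>fst c = fst x\<close> by metis
next
  assume "fst x = fst y + h \<and> (\<exists>c. covers n m x c \<and> covers n m y c)"
  then obtain c where h: "fst x = fst y + h" and c: "covers n m x c" "covers n m y c"
    by blast
  let ?c = "(fst x, map (\<lambda>t. t div int n ^ (fst c - fst x)) (snd c))"
  have "?c \<in> supp_cells m x"
    using c by (simp add: covers_def)
  moreover have "covers n m y ?c"
    using c h covers_coarsen[of y "fst x" c n m] by (auto simp: covers_iff)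
  then have "?c \<in> (cchs n ^^ h) (supp_cells m y)"
    unfolding mem_cchs_pow_iff[OF assms] covers_def using h
    by (intro bexI[of _ "(fst y, map (\<lambda>t. t div int n ^ h) (snd ?c))"]) auto
  ultimately show "\<exists>c\<in>supp_cells m x. c \<in> (cchs n ^^ h) (supp_cells m y)"
    by blast
qed


section \<open>The gap condition as a closure property\<close>

text \<open>The cell \<open>c\<close> witnesses the overlap. A difference of exactly
  \<open>G\<close> levels suffices: by \<open>lineage_ancestor\<close>, a finer \<open>x\<close> has
  an ancestor in the lineage at level \<open>fst y + G\<close> that still covers
  \<open>c\<close>.\<close>

definition gap_closed :: "nat \<Rightarrow> nat \<Rightarrow> nat \<Rightarrow> nat \<Rightarrow> idx set \<Rightarrow> bool" where
  "gap_closed d n m G L \<longleftrightarrow>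
     (\<forall>x\<in>L. \<forall>y\<in>desc d n m. \<forall>c. covers n m x c \<and> covers n m y c \<and> fst y + G = fst x \<longrightarrow> y \<in> L)"

text \<open>All ancestors of \<open>x\<close> cover \<open>c\<close>. Going up from
  \<open>x\<close>, the last one reached before entering \<open>L\<close> or passing a root belongs
  to the generator.\<close>

lemma ex_coarser_gen:
  assumes "n \<ge> 1" "x \<in> desc d n m" "x \<notin> L" "covers n m x c"
  obtains y where "y \<in> gen d n m L" "fst y \<le> fst x" "covers n m y c"
  using assms(2-)
proof (induction arbitrary: thesis rule: desc.induct)
  case (root x)
  then show ?case by (intro root.prems(1)[of x]) (auto simp: gen_def)
next
  case (child x y)
  show ?case
  proof (cases "x \<in> L")
    case True
    then show ?thesis
      using child by (intro child.prems(1)[of y]) (auto simp: gen_def mem_bchs_iff)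
  next
    case False
    then obtain z where "z \<in> gen d n m L" "fst z \<le> fst x" "covers n m z c"
      using child.IH covers_parent[OF assms(1) child.hyps(2)] child.prems by blast
    then show ?thesis
      using child by (intro child.prems(1)[of z]) (auto simp: mem_bch_iff)
  qed
qed

text \<open>Below the level of \<open>c\<close> there is always a child covering \<open>c\<close>. A
  chain of such children must leave \<open>L\<close>, whose levels are all below
  \<open>fst c\<close>, and the first one outside is in the generator.\<close>

lemma ex_finer_gen:
  assumes "n \<ge> 1" "m \<ge> 1" "\<And>x. x \<in> L \<Longrightarrow> fst x < fst c" "x \<in> L" "covers n m x c"
  obtains y where "y \<in> gen d n m L" "fst x < fst y" "covers n m y c"
  using assms(4-)
proof (induction "fst c - fst x" arbitrary: x thesis rule: less_induct)
  case less
  obtain y where y: "y \<in> bch n m x" "covers n m y c"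
    using covers_child[OF assms(1,2) less.prems(3) assms(3)[OF less.prems(2)]] .
  have lev: "fst y = Suc (fst x)"
    using y by (simp add: mem_bch_iff)
  show ?case
  proof (cases "y \<in> L")
    case True
    have "fst c - fst y < fst c - fst x"
      using lev assms(3)[OF less.prems(2)] by simp
    then obtain z where "z \<in> gen d n m L" "fst y < fst z" "covers n m z c"
      using less.hyps True y(2) by blast
    then show ?thesis
      using lev by (intro less.prems(1)[of z]) auto
  next
    case False
    then show ?thesis
      using y lev less.prems by (intro less.prems(1)[of y]) (auto simp: gen_def mem_bchs_iff)
  qed
qed

lemma ex_overlapping_finer_gen:
  assumes "n \<ge> 1" "m \<ge> 1" "finite L" "x \<in> L" "covers n m x c"
  obtains y c' where "y \<in> gen d n m L" "fst x < fst y" "covers n m y c'"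
    "\<And>z. covers n m z c \<Longrightarrow> covers n m z c'"
proof -
  obtain c' where c': "fst c' \<ge> Suc (Max (fst ` L))" "\<And>z. covers n m z c \<Longrightarrow> covers n m z c'"
    using covers_refine[OF assms(1)] by blast
  have "fst z < fst c'" if "z \<in> L" for z
    using c'(1) Max_ge[of "fst ` L" "fst z"] that assms(3)
    by (meson Suc_le_lessD finite_imageI image_eqI le_trans not_less_eq_eq)
  then show ?thesis
    using ex_finer_gen[of n m L c' x] assms c' that by metis
qed

text \<open>\<open>gapH\<close> is a \<open>Max\<close>, whose value is determined only for nonempty
  finite sets.\<close>

lemma gen_nonempty:
  assumes "n \<ge> 1" "m \<ge> 1" "finite L"
  shows "gen d n m L \<noteq> {}"
proof (cases "L = {}")
  case True
  have "(0, replicate d 0) \<in> B0 d m"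
    using assms by (auto simp: mem_B0_iff)
  then show ?thesis
    using True by (auto simp: gen_def)
next
  case False
  then obtain x where "x \<in> L" by blast
  then show ?thesis
    using ex_overlapping_finer_gen[OF assms _ covers_supp_cells[OF supp_cells_self[OF assms(2)]]]
    by (metis empty_iff)
qed

section \<open>The gap of a generator as a bound on overlapping levels\<close>

lemma Oset_neg_nonempty_iff:
  assumes "n \<ge> 1" "H \<subseteq> allB d"
  shows "Oset d n m x (- int h) H \<noteq> {} \<longleftrightarrow>
    (\<exists>y\<in>H. fst x = fst y + h \<and> (\<exists>c. covers n m x c \<and> covers n m y c))"
proof -
  have "Oset d n m x (- int h) H =
      {y \<in> H. fst x = fst y + h \<and> (\<exists>c. covers n m x c \<and> covers n m y c)}"
    unfolding supp_cells_cchs_pow_iff[OF assms(1), symmetric]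
    using assms(2) by (auto simp: Oset_def BB_def II_def cch_pow_def)
  then show ?thesis by blast
qed

lemma gapH_le_iff:
  assumes n: "n \<ge> 1" and m: "m \<ge> 1" and H: "H \<subseteq> allB d" and fin: "finite H" and ne: "H \<noteq> {}"
  shows "gapH d n m H \<le> int G \<longleftrightarrow>
    (\<forall>x\<in>H. \<forall>y\<in>H. \<forall>c. covers n m x c \<and> covers n m y c \<longrightarrow> fst x \<le> fst y + G)"
proof -
  have "gapB d n m H x \<le> int G \<longleftrightarrow>
    (\<forall>y\<in>H. \<forall>c. covers n m x c \<and> covers n m y c \<longrightarrow> fst x \<le> fst y + G)" if x: "x \<in> H" for x
  proof -
    let ?X = "{k. Oset d n m x (- k) H \<noteq> {}}"
    have iff: "int h \<in> ?X \<longleftrightarrow>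
      (\<exists>y\<in>H. fst x = fst y + h \<and> (\<exists>c. covers n m x c \<and> covers n m y c))" for h
      using Oset_neg_nonempty_iff[OF n H] by simp
    \<comment> \<open>\<open>Sup\<close> on integers is governed by upper bounds only for a nonempty
      set bounded above: \<open>x\<close> overlaps itself, and no B-spline is more than
      \<open>fst x\<close> levels coarser.\<close>
    have zero: "0 \<in> ?X"
      using iff[of 0] x covers_supp_cells[OF supp_cells_self[OF m]]
      unfolding of_nat_0 add_0_right by blast
    have "k \<le> int (fst x)" if "k \<in> ?X" for k
    proof (cases "k \<ge> 0")
      case True
      then have "int (nat k) \<in> ?X"
        using that by simp
      then obtain y where "y \<in> H" "fst x = fst y + nat k"
        unfolding iff by blast
      then show ?thesis
        using True by linarith
    qed linarith
    then have bdd: "bdd_above ?X"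
      by (auto intro!: bdd_aboveI)
    have "Sup ?X \<le> int G \<longleftrightarrow> (\<forall>k\<in>?X. k \<le> int G)"
      by (rule cSup_le_iff[OF _ bdd]) (use zero in blast)
    \<comment> \<open>Negative elements of \<open>?X\<close> are below \<open>int G\<close> anyway,
      so only naturals matter.\<close>
    also have "\<dots> \<longleftrightarrow> (\<forall>h. int h \<in> ?X \<longrightarrow> h \<le> G)"
    proof (intro iffI ballI allI impI)
      fix k assume "\<forall>h. int h \<in> ?X \<longrightarrow> h \<le> G" and "k \<in> ?X"
      then show "k \<le> int G"
        by (cases k rule: int_cases2) auto
    qed auto
    also have "\<dots> \<longleftrightarrow> (\<forall>y\<in>H. \<forall>c. covers n m x c \<and> covers n m y c \<longrightarrow> fst x \<le> fst y + G)"
      unfolding iff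
    proof (intro iffI allI ballI impI)
      fix y c assume "\<forall>h. (\<exists>y\<in>H. fst x = fst y + h \<and> (\<exists>c. covers n m x c \<and> covers n m y c)) \<longrightarrow> h \<le> G"
        and "y \<in> H" "covers n m x c \<and> covers n m y c"
      then have "fst x - fst y \<le> G" if "fst y \<le> fst x"
        using that le_add_diff_inverse[of "fst y" "fst x"] by metis
      then show "fst x \<le> fst y + G"
        by linarith
    qed auto
    finally show ?thesis
      by (simp add: gapB_def)
  qed
  then show ?thesis
    using fin ne by (simp add: gapH_def)
qed

lemma lineage_ancestor:
  assumes "n \<ge> 1" "lineage d n m L" "x \<in> L" "covers n m x c" "l \<le> fst x"
  shows "\<exists>y\<in>L. fst y = l \<and> covers n m y c"
  using assms(3-)
proof (induction "fst x - l" arbitrary: x)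
  case 0
  then show ?case by (metis diff_is_0_eq le_antisym)
next
  case (Suc k)
  then have "x \<notin> B0 d m"
    by (auto simp: mem_B0_iff)
  moreover have "x \<in> B0 d m \<union> bchs n m L"
    using Suc.prems(1) assms(2) by (auto simp: lineage_def)
  ultimately obtain z where z: "z \<in> L" "x \<in> bch n m z"
    unfolding mem_bchs_iff Un_iff by blast
  then have "fst x = Suc (fst z)"
    by (simp add: mem_bch_iff)
  then have "k = fst z - l" "l \<le> fst z"
    using Suc.hyps(2) by linarith+
  then show ?case
    using Suc.hyps(1) z(1) covers_parent[OF assms(1) z(2) Suc.prems(2)] by blast
qed

text \<open>Below \<open>x\<close> in \<open>L\<close> there is a strictly finer generator element,
  so a missing \<open>y\<close> exactly \<open>G\<close> levels coarser produces a gap above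
  \<open>G\<close>. Conversely, a generator element more than \<open>G\<close> levels finer than
  \<open>y\<close> has a parent in \<open>L\<close> at least \<open>G\<close> levels finer than
  \<open>y\<close>, which forces \<open>y\<close> into \<open>L\<close>.\<close>

lemma gapH_le_iff_gap_closed:
  assumes n: "n \<ge> 1" and m: "m \<ge> 1" and L: "lineage d n m L"
  shows "gapH d n m (gen d n m L) \<le> int G \<longleftrightarrow> gap_closed d n m G L"
proof -
  have fin: "finite L"
    using L by (simp add: lineage_def)
  have "gen d n m L \<subseteq> allB d"
    using gen_subset_desc[OF L] desc_length by (fastforce simp: allB_def)
  note gap = gapH_le_iff[OF n m this finite_gen[OF fin] gen_nonempty[OF n m fin], of G]
  show ?thesis
    unfolding gap
  proof
    assume le: "\<forall>x\<in>gen d n m L. \<forall>y\<in>gen d n m L. \<forall>c.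
      covers n m x c \<and> covers n m y c \<longrightarrow> fst x \<le> fst y + G"
    show "gap_closed d n m G L"
      unfolding gap_closed_def
    proof (intro ballI allI impI, rule ccontr)
      fix x y c
      assume x: "x \<in> L" and y: "y \<in> desc d n m" "y \<notin> L"
        and c: "covers n m x c \<and> covers n m y c \<and> fst y + G = fst x"
      obtain y' where y': "y' \<in> gen d n m L" "fst y' \<le> fst y" "covers n m y' c"
        using ex_coarser_gen[OF n y] c by blast
      obtain x' c' where "x' \<in> gen d n m L" "fst x < fst x'" "covers n m x' c'"
        "\<And>z. covers n m z c \<Longrightarrow> covers n m z c'"
        using ex_overlapping_finer_gen[OF n m fin x] c by metis
      then show False
        using le y' c by fastforce
    qed
  next
    assume cl: "gap_closed d n m G L"
    show "\<forall>x\<in>gen d n m L. \<forall>y\<in>gen d n m L. \<forall>c.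
      covers n m x c \<and> covers n m y c \<longrightarrow> fst x \<le> fst y + G"
    proof (intro ballI allI impI, rule ccontr)
      fix x y c
      assume x: "x \<in> gen d n m L" and y: "y \<in> gen d n m L"
        and c: "covers n m x c \<and> covers n m y c" and "\<not> fst x \<le> fst y + G"
      then have lt: "fst y + G < fst x" by simp
      then have "x \<notin> B0 d m"
        by (auto simp: mem_B0_iff)
      then obtain z where z: "z \<in> L" "x \<in> bch n m z"
        using x by (auto simp: gen_def mem_bchs_iff)
      moreover have "fst y + G \<le> fst z"
        using z lt by (auto simp: mem_bch_iff)
      ultimately obtain w where "w \<in> L" "fst w = fst y + G" "covers n m w c"
        using lineage_ancestor[OF n L z(1) covers_parent[OF n z(2)]] c by blast
      then have "y \<in> L"
        using cl[unfolded gap_closed_def, rule_format, of w y c] c gen_subset_desc[OF L] y by auto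
      then show False
        using y by (simp add: gen_def)
    qed
  qed
qed


section \<open>Absorption does not enlarge the covered region\<close>

definition cells :: "nat \<Rightarrow> idx set \<Rightarrow> idx set" where
  "cells m L = (\<Union>x\<in>L. supp_cells m x)"

text \<open>An index stands both for a B-spline and for the lower corner cell of its
  support.\<close>

lemma subset_cells: "m \<ge> 1 \<Longrightarrow> L \<subseteq> cells m L"
  using supp_cells_self by (force simp: cells_def)

lemma cells_mono: "L \<subseteq> L' \<Longrightarrow> cells m L \<subseteq> cells m L'"
  by (auto simp: cells_def)

lemma finite_cells: "finite L \<Longrightarrow> finite (cells m L)"
  by (simp add: cells_def finite_supp_cells)

text \<open>The union of all lineages above \<open>L\<close> that cover no new cell is again one. It
  is absorbing, since an offending generator element could be added to it, and so it contains the
  least absorbing \<open>L'\<close>.\<close>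

lemma abs_rel_cells:
  assumes m: "m \<ge> 1" and L: "lineage d n m L" and abs: "abs_rel d n m L L'"
  shows "cells m L' = cells m L"
proof
  define F where "F = {X. lineage d n m X \<and> L \<subseteq> X \<and> cells m X \<subseteq> cells m L}"
  let ?X = "\<Union>F"
  have "X \<subseteq> cells m L" if "X \<in> F" for X
    using that subset_cells[OF m, of X] by (auto simp: F_def)
  then have fin: "finite ?X"
    using finite_cells L by (meson Sup_least finite_subset lineage_def)
  have sub: "X \<subseteq> B0 d m \<union> bchs n m ?X" "X \<subseteq> allB d" if "X \<in> F" for X
    using that bchs_mono[of X ?X n m] by (auto simp: F_def lineage_def)
  then have "?X \<subseteq> B0 d m \<union> bchs n m ?X" "?X \<subseteq> allB d"
    by (meson Sup_least)+
  then have lin: "lineage d n m ?X"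
    using fin unfolding lineage_def by blast
  have "L \<in> F"
    using L by (simp add: F_def)
  then have LX: "L \<subseteq> ?X"
    by blast
  have cX: "cells m ?X \<subseteq> cells m L"
    unfolding F_def cells_def by blast
  have "absorbing d n m ?X"
    unfolding absorbing_def
  proof (intro ballI notI)
    fix x assume x: "x \<in> gen d n m ?X" and "supp_cells m x \<subseteq> (\<Union>y\<in>?X. supp_cells m y)"
    then have "cells m (insert x ?X) \<subseteq> cells m L"
      using cX unfolding cells_def by blast
    moreover have "x \<in> allB d"
      using x gen_subset_desc[OF lin] desc_length[of x] by (cases x) (auto simp: allB_def)
    then have "lineage d n m (insert x ?X)"
      using lin x bchs_mono[of ?X "insert x ?X" n m] unfolding lineage_def gen_def by blast
    ultimately have "insert x ?X \<in> F"
      using LX unfolding F_def by blast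
    then show False
      using x by (auto simp: gen_def)
  qed
  then have "L' \<subseteq> ?X"
    using abs lin LX unfolding abs_rel_def by blast
  then show "cells m L' \<subseteq> cells m L"
    using cX cells_mono by blast
  show "cells m L \<subseteq> cells m L'"
    using abs cells_mono by (simp add: abs_rel_def)
qed

text \<open>The condition depends on \<open>x\<close> only through its level and the cells it
  covers; a \<open>z\<close> in \<open>L\<close> of the same level whose support contains the
  relevant cell takes over the role of \<open>x\<close>.\<close>

lemma gap_closed_cells:
  assumes "gap_closed d n m G L" "L \<subseteq> L'" "cells m L' = cells m L"
  shows "gap_closed d n m G L'"
  unfolding gap_closed_def
proof (intro ballI allI impI)
  fix x y c
  assume x: "x \<in> L'" and y: "y \<in> desc d n m"
    and c: "covers n m x c \<and> covers n m y c \<and> fst y + G = fst x"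
  let ?c = "(fst x, map (\<lambda>t. t div int n ^ (fst c - fst x)) (snd c))"
  have "?c \<in> supp_cells m x"
    using c by (simp add: covers_def)
  then have "?c \<in> cells m L"
    using x assms(3) unfolding cells_def by blast
  then obtain z where z: "z \<in> L" "?c \<in> supp_cells m z"
    unfolding cells_def by blast
  then have "fst z = fst x"
    by (simp add: mem_supp_cells_iff)
  then have "covers n m z c"
    using z(2) c by (simp add: covers_def)
  then have "y \<in> L"
    using assms(1)[unfolded gap_closed_def, rule_format, OF z(1) y, of c] c \<open>fst z = fst x\<close> by simp
  then show "y \<in> L'"
    using assms(2) by blast
qed


section \<open>Distances\<close>

text \<open>Lower corner of a support or cell in unscaled coordinates, comparable across
  levels.\<close>

definition pos :: "nat \<Rightarrow> idx \<Rightarrow> nat \<Rightarrow> real" where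
  "pos n x j = real_of_int (snd x ! j) / real n ^ fst x"

definition near :: "nat \<Rightarrow> nat \<Rightarrow> real \<Rightarrow> idx \<Rightarrow> idx \<Rightarrow> bool" where
  "near d n r x y \<longleftrightarrow> (\<forall>j<d. \<bar>pos n x j - pos n y j\<bar> \<le> r)"

lemma near_refl: "0 \<le> r \<Longrightarrow> near d n r x x"
  by (simp add: near_def)

lemma near_trans: "near d n r x y \<Longrightarrow> near d n s y z \<Longrightarrow> near d n (r + s) x z"
  unfolding near_def by (smt (verit))

lemma near_sym: "near d n r x y \<Longrightarrow> near d n r y x"
  unfolding near_def by (simp add: abs_minus_commute)

lemma near_mono: "near d n r x y \<Longrightarrow> r \<le> s \<Longrightarrow> near d n s x y"
  unfolding near_def by (meson order_trans)

lemma pos_covers: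
  assumes n: "n \<ge> 1" and c: "covers n m x c" and j: "j < length (snd x)"
  shows "pos n x j \<le> pos n c j" "pos n c j \<le> pos n x j + real m / real n ^ fst x"
proof -
  let ?h = "fst c - fst x"
  have b: "snd x ! j * int n ^ ?h \<le> snd c ! j" "snd c ! j < (snd x ! j + int m) * int n ^ ?h"
    using c j n le_zdiv_iff[of "int n ^ ?h" "snd x ! j" "snd c ! j"]
      zdiv_less_iff[of "int n ^ ?h" "snd c ! j" "snd x ! j + int m"]
    by (force simp: covers_iff)+
  have "real_of_int (snd x ! j) * real n ^ ?h \<le> real_of_int (snd c ! j)"
    using of_int_le_iff[where 'a=real, THEN iffD2, OF b(1)] by simp
  moreover have "real_of_int (snd c ! j) \<le> (real_of_int (snd x ! j) + real m) * real n ^ ?h"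
    using of_int_less_iff[where 'a=real, THEN iffD2, OF b(2)] by simp
  moreover have "real n ^ fst c = real n ^ fst x * real n ^ ?h"
    using c by (simp add: covers_def flip: power_add)
  ultimately show "pos n x j \<le> pos n c j" "pos n c j \<le> pos n x j + real m / real n ^ fst x"
    using n by (simp_all add: pos_def field_simps)
qed

lemma inverse_power_antimono:
  "1 \<le> n \<Longrightarrow> k \<le> l \<Longrightarrow> 0 \<le> r \<Longrightarrow> r / real n ^ l \<le> r / real n ^ k"
  by (intro divide_left_mono) (auto intro: power_increasing)

text \<open>In each coordinate both lower corners are at most that of \<open>c\<close>, by at most
  \<open>m / n ^ l\<close> for the respective level \<open>l\<close>; the coarser level
  dominates.\<close>

lemma near_covers:
  assumes "n \<ge> 1" "length (snd x) = d" "length (snd y) = d" "fst y \<le> fst x"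
    "covers n m x c" "covers n m y c"
  shows "near d n (real m / real n ^ fst y) x y"
  unfolding near_def
proof (intro allI impI)
  fix j assume "j < d"
  then show "\<bar>pos n x j - pos n y j\<bar> \<le> real m / real n ^ fst y"
    using assms(2,3) pos_covers[OF assms(1,5), of j] pos_covers[OF assms(1,6), of j]
      inverse_power_antimono[OF assms(1,4), of "real m"] by auto
qed

lemma near_bch:
  assumes "n \<ge> 1" "m \<ge> 1" "length (snd x) = d" "y \<in> bch n m x"
  shows "near d n (real m / real n ^ fst x) y x"
proof (rule near_covers)
  show "covers n m y y"
    by (rule covers_supp_cells[OF supp_cells_self[OF assms(2)]])
  then show "covers n m x y"
    by (rule covers_parent[OF assms(1,4)])
qed (use assms in \<open>auto simp: mem_bch_iff\<close>)


section \<open>The gap closure of a single B-spline\<close>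

text \<open>Orbit of \<open>phi\<close> under the rule of \<open>gap_closed\<close>; it bounds what
  \<open>GC\<close> adds.\<close>

inductive_set gap_hull :: "nat \<Rightarrow> nat \<Rightarrow> nat \<Rightarrow> nat \<Rightarrow> idx \<Rightarrow> idx set" for d n m G phi where
  self: "phi \<in> gap_hull d n m G phi"
| coarser: "x \<in> gap_hull d n m G phi \<Longrightarrow> y \<in> desc d n m \<Longrightarrow> covers n m x c \<Longrightarrow> covers n m y c \<Longrightarrow>
    fst y + G = fst x \<Longrightarrow> y \<in> gap_hull d n m G phi"

text \<open>If \<open>x\<close> is a child of \<open>x'\<close> in \<open>L\<close> and
  \<open>y\<close> a child of \<open>y'\<close>, then \<open>x'\<close> and \<open>y'\<close> again
  overlap and differ by \<open>G\<close> levels, so \<open>y'\<close> is in \<open>L\<close>. In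
  such a step \<open>G \<ge> 1\<close> keeps \<open>x\<close> from being a root. Hence adding the
  hull preserves the lineage property.\<close>

lemma gap_hull_subset:
  assumes "n \<ge> 1" "G \<ge> 1" "gap_closed d n m G L" "phi \<in> B0 d m \<union> bchs n m L"
  shows "gap_hull d n m G phi \<subseteq> B0 d m \<union> bchs n m L"
proof
  fix x assume "x \<in> gap_hull d n m G phi"
  then show "x \<in> B0 d m \<union> bchs n m L"
  proof induction
    case (coarser x y c)
    show ?case
    proof (cases "y \<in> B0 d m")
      case False
      then obtain y' where y': "y' \<in> desc d n m" "y \<in> bch n m y'"
        using coarser.hyps by (metis desc.cases)
      have "x \<notin> B0 d m"
        using coarser.hyps(5) assms(2) by (simp add: mem_B0_iff)
      then obtain x' where x': "x' \<in> L" "x \<in> bch n m x'"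
        using coarser.IH unfolding Un_iff mem_bchs_iff by blast
      have "fst y' + G = fst x'"
        using coarser.hyps(5) x' y' by (simp add: mem_bch_iff)
      then have "y' \<in> L"
        using assms(3)[unfolded gap_closed_def, rule_format, OF x'(1) y'(1), of c]
          covers_parent[OF assms(1) x'(2) coarser.hyps(3)]
          covers_parent[OF assms(1) y'(2) coarser.hyps(4)] by blast
      then show ?thesis
        using y'(2) unfolding Un_iff mem_bchs_iff by blast
    qed blast
  qed (rule assms(4))
qed

lemma near_gap_hull:
  assumes n: "n \<ge> 2" and "G \<ge> 1" and phi: "phi \<in> desc d n m" and x: "x \<in> gap_hull d n m G phi"
  shows "fst x \<le> fst phi \<and> x \<in> desc d n m \<and> near d n (2 * real m / real n ^ fst x) x phi"
  using x
proof induction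
  case self
  then show ?case
    using phi by (auto intro: near_refl)
next
  case (coarser x y c)
  have "fst y < fst x"
    using coarser.hyps(5) \<open>G \<ge> 1\<close> by simp
  have "near d n (real m / real n ^ fst y) y x"
    using near_sym[OF near_covers[of n x d y m c]] coarser.IH coarser.hyps n
      desc_length[of x d n m] desc_length[of y d n m] \<open>fst y < fst x\<close> by auto
  then have "near d n (real m / real n ^ fst y + 2 * real m / real n ^ fst x) y phi"
    using coarser.IH near_trans by blast
  \<comment> \<open>Source of the factor 2: the level drops by at least one and
    \<open>n \<ge> 2\<close>, so the bound for all earlier steps is at most the cost
    \<open>m / n ^ fst y\<close> of the last one.\<close>
  moreover have "2 * real m / real n ^ fst x \<le> real m / real n ^ fst y"
  proof -
    have "2 * real m / real n ^ fst x \<le> 2 * real m / real n ^ Suc (fst y)"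
      using \<open>fst y < fst x\<close> n by (intro inverse_power_antimono) auto
    also have "\<dots> = (2 / real n) * (real m / real n ^ fst y)"
      by simp
    also have "\<dots> \<le> 1 * (real m / real n ^ fst y)"
      using n by (intro mult_right_mono) auto
    finally show ?thesis by simp
  qed
  ultimately have "near d n (2 * real m / real n ^ fst y) y phi"
    by (elim near_mono) simp
  then show ?case
    using coarser.IH coarser.hyps \<open>fst y < fst x\<close> by auto
qed

text \<open>\<open>L\<close> joined with the hull is a gap-closed lineage, so it competes with
  \<open>L'\<close> in the minimality clause of \<open>GC_rel\<close>.\<close>

lemma GC_rel_new:
  assumes n: "n \<ge> 2" and m: "m \<ge> 1" and G: "G \<ge> 1" and L: "lineage d n m L" and cl: "gap_closed d n m G L"
    and phi: "phi \<in> gen d n m L" and GC: "GC_rel d n m (int G) L phi L'"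
  shows "lineage d n m L' \<and> gap_closed d n m G L' \<and> L' \<subseteq> L \<union> gap_hull d n m G phi"
proof -
  let ?E = "gap_hull d n m G phi"
  have n1: "n \<ge> 1"
    using n by simp
  have fin: "finite L"
    using L by (simp add: lineage_def)
  have phi': "phi \<in> B0 d m \<union> bchs n m L"
    using phi by (simp add: gen_def)
  have E: "?E \<subseteq> B0 d m \<union> bchs n m L"
    by (rule gap_hull_subset[OF n1 G cl phi'])
  have "?E \<subseteq> desc d n m"
    using near_gap_hull[OF n G] gen_subset_desc[OF L] phi by blast
  then have EB: "?E \<subseteq> allB d"
    using desc_length by (fastforce simp: allB_def)
  have "finite (B0 d m \<union> bchs n m L)"
    using fin by (simp add: finite_B0 bchs_def finite_bch)
  then have "finite ?E"
    using E finite_subset by blast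
  then have lin: "lineage d n m (L \<union> ?E)"
    using L E EB bchs_mono[of L "L \<union> ?E" n m] unfolding lineage_def by blast
  have "gap_closed d n m G (L \<union> ?E)"
    using cl gap_hull.coarser[of _ d n m G phi] unfolding gap_closed_def by blast
  then have "gapH d n m (gen d n m (L \<union> ?E)) \<le> int G"
    using gapH_le_iff_gap_closed[OF n1 m lin] by simp
  moreover have "insert phi L \<subseteq> L \<union> ?E"
    using gap_hull.self by blast
  ultimately have "L' \<subseteq> L \<union> ?E"
    using GC lin unfolding GC_rel_def by blast
  then show ?thesis
    using GC gapH_le_iff_gap_closed[OF n1 m, of d L' G] unfolding GC_rel_def by blast
qed


section \<open>Chains of marked B-splines\<close>

text \<open>The greedy weight \<open>1 / n ^ (fst y - l)\<close> collected along the chain of ancestors in \<open>P\<close> also measures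
  the distance travelled in units of \<open>1 / n ^ l\<close>. Stopping as soon as the weight reaches \<open>v\<close> therefore
  bounds both; a chain ends at the latest when it hits level \<open>l\<close>, where the weight is 1.\<close>
definition rich :: "nat \<Rightarrow> nat \<Rightarrow> nat \<Rightarrow> idx set \<Rightarrow> idx \<Rightarrow> bool" where
  "rich d n m P x \<longleftrightarrow> (\<forall>l\<le>fst x. \<forall>v. 0 < v \<and> v \<le> 1 \<longrightarrow>
     (\<exists>S\<subseteq>P. v \<le> (\<Sum>y\<in>S. 1 / real n ^ (fst y - l)) \<and>
        (\<forall>y\<in>S. l \<le> fst y \<and> near d n (4 * real m * real n * v / real n ^ l) x y)))"

lemma rich_mono: "rich d n m P x \<Longrightarrow> P \<subseteq> P' \<Longrightarrow> rich d n m P' x"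
  unfolding rich_def by (meson order_trans)

text \<open>\<open>x\<close> spends its own weight \<open>?w\<close> first and asks
  \<open>x'\<close> for the rest \<open>v - ?w\<close>; as \<open>x\<close> is fresh, its weight is
  not counted twice.\<close>

lemma rich_insert:
  assumes n: "n \<ge> 1" and P: "finite P" "x \<notin> P"
    and parent: "fst x > 0 \<Longrightarrow> \<exists>x'\<in>P. rich d n m P x' \<and> fst x \<le> Suc (fst x') \<and>
      near d n (4 * real m * real n / real n ^ fst x) x x'"
  shows "rich d n m (insert x P) x"
  unfolding rich_def
proof (intro allI impI)
  fix l v assume l: "l \<le> fst x" and v: "0 < v \<and> v \<le> (1::real)"
  let ?D = "4 * real m * real n" and ?w = "1 / real n ^ (fst x - l)"
  have nn: "near d n (?D * v / real n ^ l) x x"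
    using v n by (intro near_refl) auto
  show "\<exists>S\<subseteq>insert x P. v \<le> (\<Sum>y\<in>S. 1 / real n ^ (fst y - l)) \<and>
        (\<forall>y\<in>S. l \<le> fst y \<and> near d n (?D * v / real n ^ l) x y)"
  proof (cases "v \<le> ?w")
    case True
    then show ?thesis
      using nn l by (intro exI[of _ "{x}"]) auto
  next
    case False
    \<comment> \<open>At level \<open>l\<close> the weight of \<open>x\<close> alone is 1, which
      meets any \<open>v \<le> 1\<close>.\<close>
    then have "fst x - l \<noteq> 0"
      using v by (cases "fst x - l") auto
    then have "l < fst x"
      by simp
    then obtain x' where x': "x' \<in> P" "rich d n m P x'" "fst x \<le> Suc (fst x')"
      "near d n (?D / real n ^ fst x) x x'"
      using parent by auto
    have "0 \<le> ?w"
      by simp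
    then have v': "0 < v - ?w \<and> v - ?w \<le> 1"
      using False v by linarith
    obtain S where S: "S \<subseteq> P" "v - ?w \<le> (\<Sum>y\<in>S. 1 / real n ^ (fst y - l))"
      "\<And>y. y \<in> S \<Longrightarrow> l \<le> fst y \<and> near d n (?D * (v - ?w) / real n ^ l) x' y"
      using x'(2)[unfolded rich_def, rule_format, OF _ v', of l] x'(3) \<open>l < fst x\<close> by auto
    \<comment> \<open>The move from \<open>x\<close> to \<open>x'\<close> costs
      \<open>?D * ?w / n ^ l\<close>, exactly the part of the radius that the weight
      \<open>?w\<close> pays for.\<close>
    have "real n ^ fst x = real n ^ l * real n ^ (fst x - l)"
      using l by (simp flip: power_add)
    then have eq: "?D / real n ^ fst x + ?D * (v - ?w) / real n ^ l = ?D * v / real n ^ l"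
      using n by (simp add: field_simps)
    have "near d n (?D * v / real n ^ l) x y" if "y \<in> S" for y
      using near_trans[OF x'(4), of "?D * (v - ?w) / real n ^ l" y] S(3)[OF that] unfolding eq by blast
    moreover have "(\<Sum>y\<in>insert x S. 1 / real n ^ (fst y - l)) = ?w + (\<Sum>y\<in>S. 1 / real n ^ (fst y - l))"
      using S(1) P finite_subset by (intro sum.insert) blast+
    ultimately show ?thesis
      using S nn l by (intro exI[of _ "insert x S"]) auto
  qed
qed

text \<open>\<open>P\<close> collects the marked B-splines on which \<open>GC\<close> was run. The
  last clause speaks of cells, not of members of \<open>L\<close>, so that absorption leaves it
  intact.\<close>

definition marked_inv :: "nat \<Rightarrow> nat \<Rightarrow> nat \<Rightarrow> nat \<Rightarrow> idx set \<Rightarrow> idx set \<Rightarrow> bool" where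
  "marked_inv d n m G L P \<longleftrightarrow> lineage d n m L \<and> gap_closed d n m G L \<and> finite P \<and> P \<subseteq> L \<and>
     (\<forall>x\<in>P. rich d n m P x) \<and>
     (\<forall>c\<in>cells m L. \<exists>x\<in>P. fst c \<le> fst x \<and> near d n (3 * real m / real n ^ fst c) c x)"

lemma marked_inv_GC:
  assumes n: "n \<ge> 2" and m: "m \<ge> 1" and G: "G \<ge> 1" and inv: "marked_inv d n m G L P"
    and phi: "phi \<in> gen d n m L" and GC: "GC_rel d n m (int G) L phi L'"
  shows "marked_inv d n m G L' (insert phi P)"
proof -
  have L: "lineage d n m L" and cl: "gap_closed d n m G L" and P: "finite P" "P \<subseteq> L"
    and rich: "\<And>x. x \<in> P \<Longrightarrow> rich d n m P x"
    and cov: "\<And>c. c \<in> cells m L \<Longrightarrow>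
      \<exists>x\<in>P. fst c \<le> fst x \<and> near d n (3 * real m / real n ^ fst c) c x"
    using inv by (auto simp: marked_inv_def)
  have new: "lineage d n m L'" "gap_closed d n m G L'" "L' \<subseteq> L \<union> gap_hull d n m G phi"
    using GC_rel_new[OF n m G L cl phi GC] by auto
  have phiD: "phi \<in> desc d n m"
    using phi gen_subset_desc[OF L] by blast
  have "rich d n m (insert phi P) phi"
  proof (rule rich_insert[OF _ P(1)])
    show "phi \<notin> P"
      using phi P by (auto simp: gen_def)
    assume "fst phi > 0"
    then obtain y where y: "y \<in> L" "phi \<in> bch n m y"
      using phi unfolding gen_def Diff_iff Un_iff mem_bchs_iff mem_B0_iff by force
    then have lev: "fst phi = Suc (fst y)"
      by (simp add: mem_bch_iff)
    obtain x where x: "x \<in> P" "fst y \<le> fst x" "near d n (3 * real m / real n ^ fst y) y x"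
      using cov y(1) subset_cells[OF m, of L] by blast
    \<comment> \<open>Distance \<open>m\<close> to the parent and \<open>3 * m\<close> on to a
      marked \<open>x\<close>, in units of \<open>1 / n ^ fst y\<close>; one level finer this
      becomes \<open>4 * m * n\<close>.\<close>
    have "near d n (real m / real n ^ fst y) phi y"
      using y n m lineage_subset_desc[OF L] desc_length[of y d n m] by (intro near_bch) auto
    then have "near d n (real m / real n ^ fst y + 3 * real m / real n ^ fst y) phi x"
      using near_trans x(3) by blast
    also have "real m / real n ^ fst y + 3 * real m / real n ^ fst y
        = 4 * real m * real n / real n ^ fst phi"
      using n lev by (simp add: field_simps)
    finally show "\<exists>x'\<in>P. rich d n m P x' \<and> fst phi \<le> Suc (fst x') \<and>
        near d n (4 * real m * real n / real n ^ fst phi) phi x'"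
      using x(2) rich[OF x(1)] lev by (intro bexI[OF _ x(1)] conjI) simp_all
  qed (use n in simp)
  then have "\<forall>x\<in>insert phi P. rich d n m (insert phi P) x"
    using rich rich_mono[of d n m P _ "insert phi P"] by blast
  moreover have "\<exists>x\<in>insert phi P. fst c \<le> fst x \<and> near d n (3 * real m / real n ^ fst c) c x"
    if c': "c \<in> cells m L'" for c
  proof (cases "c \<in> cells m L")
    case True
    then show ?thesis
      using cov by (meson insertI2)
  next
    case False
    obtain x where "x \<in> L'" "c \<in> supp_cells m x"
      using c' unfolding cells_def by blast
    moreover from this have "x \<notin> L"
      using False unfolding cells_def by blast
    ultimately have x: "x \<in> gap_hull d n m G phi" "c \<in> supp_cells m x"
      using new(3) by auto
    note hull = near_gap_hull[OF n G phiD x(1)]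
    have c: "fst c = fst x" "length (snd c) = d" "length (snd x) = d"
      using x(2) hull desc_length[of x] by (auto simp: mem_supp_cells_iff)
    then have "near d n (real m / real n ^ fst x) c x"
      using n covers_supp_cells[OF x(2)] covers_supp_cells[OF supp_cells_self[OF m]]
      by (intro near_covers[of n c d x m c]) auto
    \<comment> \<open>The constant 3: \<open>m\<close> from the cell to its B-spline
      \<open>x\<close>, \<open>2 * m\<close> from \<open>x\<close> to \<open>phi\<close>.\<close>
    then have "near d n (real m / real n ^ fst x + 2 * real m / real n ^ fst x) c phi"
      using hull near_trans by blast
    then show ?thesis
      using c hull by (intro bexI[of _ phi]) (auto elim: near_mono)
  qed
  moreover have "insert phi P \<subseteq> L'"
    using GC P unfolding GC_rel_def by blast
  ultimately show ?thesis
    using new P unfolding marked_inv_def by blast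
qed

lemma marked_inv_loop:
  assumes "ga_loop d n m (int G) M L L'" "n \<ge> 2" "m \<ge> 1" "G \<ge> 1" "marked_inv d n m G L P"
  shows "\<exists>P'. marked_inv d n m G L' P' \<and> P' \<subseteq> P \<union> M"
  using assms
proof (induction arbitrary: P rule: ga_loop.induct)
  case (step phi L L2 Lf)
  then have "marked_inv d n m G L2 (insert phi P)"
    using marked_inv_GC by blast
  then obtain P' where "marked_inv d n m G Lf P'" "P' \<subseteq> insert phi P \<union> M"
    using step by blast
  then show ?case
    using step.hyps(1) by blast
qed blast

lemma marked_inv_absorb:
  assumes "m \<ge> 1" "marked_inv d n m G L P" "abs_rel d n m L L'"
  shows "marked_inv d n m G L' P"
proof -
  have "cells m L' = cells m L"
    using abs_rel_cells assms by (auto simp: marked_inv_def)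
  moreover have "L \<subseteq> L'" "lineage d n m L'"
    using assms(3) by (auto simp: abs_rel_def)
  ultimately show ?thesis
    using assms(2) gap_closed_cells[of d n m G L L'] unfolding marked_inv_def by auto
qed


section \<open>Counting\<close>

lemma sum_inverse_powers_le:
  assumes "n \<ge> 2"
  shows "(\<Sum>l\<le>N. 1 / real n ^ (N - l)) \<le> 2"
proof (induction N)
  case (Suc N)
  have "(\<Sum>l\<le>Suc N. 1 / real n ^ (Suc N - l)) = (\<Sum>l\<le>N. 1 / real n ^ (Suc N - l)) + 1"
    by simp
  also have "(\<Sum>l\<le>N. 1 / real n ^ (Suc N - l)) = (\<Sum>l\<le>N. 1 / real n ^ (N - l)) / real n"
    unfolding sum_divide_distrib by (intro sum.cong) (auto simp: Suc_diff_le)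
  also have "\<dots> \<le> 2 / 2"
    using Suc assms by (intro frac_le) (auto intro: sum_nonneg)
  finally show ?case by simp
qed simp

lemma card_near_level_le:
  assumes n: "n \<ge> 1" and X: "\<And>x. x \<in> X \<Longrightarrow> fst x = l \<and> length (snd x) = d \<and> near d n (real A / real n ^ l) x y"
  shows "card X \<le> (2 * A + 2) ^ d"
proof -
  \<comment> \<open>Rounding the centre down to an integer shifts the differences by less than one,
    which \<open>{- int A..int A + 1}\<close> allows for.\<close>
  let ?f = "\<lambda>j. \<lfloor>real n ^ l * pos n y j\<rfloor>"
  have "snd x ! j - ?f j \<in> {- int A..int A + 1}" if "x \<in> X" "j < d" for x j
  proof -
    have "\<bar>real_of_int (snd x ! j) / real n ^ l - pos n y j\<bar> \<le> real A / real n ^ l"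
      using X[OF that(1)] that(2) unfolding near_def pos_def by blast
    then have "real n ^ l * \<bar>real_of_int (snd x ! j) / real n ^ l - pos n y j\<bar>
        \<le> real n ^ l * (real A / real n ^ l)"
      by (intro mult_left_mono) auto
    moreover have "real n ^ l * \<bar>real_of_int (snd x ! j) / real n ^ l - pos n y j\<bar>
        = \<bar>real n ^ l * (real_of_int (snd x ! j) / real n ^ l - pos n y j)\<bar>"
      by (simp add: abs_mult)
    ultimately have "\<bar>real_of_int (snd x ! j) - real n ^ l * pos n y j\<bar> \<le> real A"
      using n by (simp add: right_diff_distrib)
    then show ?thesis
      unfolding atLeastAtMost_iff by linarith
  qed
  then have "card X \<le> card {- int A..int A + 1} ^ d"
    using X by (intro finite_card_levelset(2)[where f = ?f and l = l]) auto
  also have "card {- int A..int A + 1} = 2 * A + 2"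
    by simp
  finally show ?thesis .
qed

lemma card_lineage_le:
  assumes n: "n \<ge> 2" and m: "m \<ge> 1" and inv: "marked_inv d n m G L P"
  shows "real (card L) \<le> 2 * real ((2 * (3 * m + 4 * m * n) + 2) ^ d) * real (card P)"
proof -
  \<comment> \<open>\<open>3 * m\<close> from a member of \<open>L\<close> to a marked B-spline,
    plus \<open>4 * m * n\<close> along its chain with \<open>v = 1\<close>.\<close>
  let ?A = "3 * m + 4 * m * n"
  let ?C = "real ((2 * ?A + 2) ^ d)"
  let ?R = "\<lambda>x y. fst x \<le> fst y \<and> near d n (real ?A / real n ^ fst x) x y"
  let ?W = "\<lambda>x y. if ?R x y then 1 / real n ^ (fst y - fst x) else 0"
  have L: "lineage d n m L" and P: "finite P"
    and rich: "\<And>x. x \<in> P \<Longrightarrow> rich d n m P x"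
    and cov: "\<And>c. c \<in> cells m L \<Longrightarrow>
      \<exists>x\<in>P. fst c \<le> fst x \<and> near d n (3 * real m / real n ^ fst c) c x"
    using inv by (auto simp: marked_inv_def)
  have fin: "finite L"
    using L by (simp add: lineage_def)
  \<comment> \<open>\<open>subset_cells\<close> identifies a B-spline with the lowest corner cell of its support.\<close>
  have low: "1 \<le> (\<Sum>y\<in>P. ?W x y)" if x: "x \<in> L" for x
  proof -
    obtain z where z: "z \<in> P" "fst x \<le> fst z" "near d n (3 * real m / real n ^ fst x) x z"
      using cov x subset_cells[OF m, of L] by blast
    obtain S where S: "S \<subseteq> P" "1 \<le> (\<Sum>y\<in>S. 1 / real n ^ (fst y - fst x))"
      "\<And>y. y \<in> S \<Longrightarrow> fst x \<le> fst y \<and> near d n (4 * real m * real n * 1 / real n ^ fst x) z y"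
      using rich[OF z(1), unfolded rich_def, rule_format, OF z(2), of 1] by auto
    have "?R x y" if "y \<in> S" for y
    proof -
      have "near d n (3 * real m / real n ^ fst x + 4 * real m * real n * 1 / real n ^ fst x) x y"
        using near_trans z(3) S(3)[OF that] by blast
      then show ?thesis
        using S(3)[OF that] by (auto simp: add_divide_distrib)
    qed
    then have "(\<Sum>y\<in>S. 1 / real n ^ (fst y - fst x)) = (\<Sum>y\<in>S. ?W x y)"
      by (intro sum.cong) auto
    also have "\<dots> \<le> (\<Sum>y\<in>P. ?W x y)"
      using P S(1) by (intro sum_mono2) auto
    finally show ?thesis
      using S(2) by linarith
  qed
  \<comment> \<open>On each level at most \<open>?C\<close> members of \<open>L\<close> lie within
    reach of \<open>y\<close>, and the weights of the levels sum to at most 2.\<close>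
  have up: "(\<Sum>x\<in>L. ?W x y) \<le> 2 * ?C" for y
  proof -
    let ?X = "{x \<in> L. ?R x y}"
    have "(\<Sum>x\<in>L. ?W x y) = (\<Sum>x\<in>?X. 1 / real n ^ (fst y - fst x))"
      using fin by (simp add: sum.inter_filter)
    also have "\<dots> = (\<Sum>l\<le>fst y. \<Sum>x | x \<in> ?X \<and> fst x = l. 1 / real n ^ (fst y - fst x))"
      using fin by (intro sum.group[symmetric]) auto
    also have "\<dots> \<le> (\<Sum>l\<le>fst y. ?C * (1 / real n ^ (fst y - l)))"
    proof (intro sum_mono)
      fix l
      let ?Y = "{x \<in> ?X. fst x = l}"
      have "length (snd x) = d" if "x \<in> L" for x
        using that lineage_subset_desc[OF L] desc_length by blast
      then have "card ?Y \<le> (2 * ?A + 2) ^ d"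
        using n by (intro card_near_level_le[where n = n and l = l and y = y]) auto
      then have "real (card ?Y) \<le> ?C"
        by (rule of_nat_mono)
      then have "real (card ?Y) * (1 / real n ^ (fst y - l)) \<le> ?C * (1 / real n ^ (fst y - l))"
        by (intro mult_right_mono) auto
      moreover have "(\<Sum>x\<in>?Y. 1 / real n ^ (fst y - fst x)) = real (card ?Y) * (1 / real n ^ (fst y - l))"
        by simp
      ultimately show "(\<Sum>x\<in>?Y. 1 / real n ^ (fst y - fst x)) \<le> ?C * (1 / real n ^ (fst y - l))"
        by linarith
    qed
    also have "\<dots> = ?C * (\<Sum>l\<le>fst y. 1 / real n ^ (fst y - l))"
      by (rule sum_distrib_left[symmetric])
    also have "\<dots> \<le> ?C * 2"
      by (intro mult_left_mono sum_inverse_powers_le[OF n]) simp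
    finally show ?thesis by simp
  qed
  have "real (card L) = (\<Sum>x\<in>L. 1)"
    by simp
  also have "\<dots> \<le> (\<Sum>x\<in>L. \<Sum>y\<in>P. ?W x y)"
    by (intro sum_mono low)
  also have "\<dots> = (\<Sum>y\<in>P. \<Sum>x\<in>L. ?W x y)"
    by (rule sum.swap)
  also have "\<dots> \<le> (\<Sum>y\<in>P. 2 * ?C)"
    by (intro sum_mono up)
  finally show ?thesis
    by (simp add: mult.commute)
qed

section \<open>From lineages to generators\<close>

lemma card_gen_le:
  assumes "n \<ge> 1" "lineage d n m L"
  shows "card (gen d n m L) \<le> card (B0 d m) + (n * m + 1) ^ d * card L"
proof -
  have fin: "finite L" and len: "\<And>x. x \<in> L \<Longrightarrow> length (snd x) = d"
    using assms lineage_subset_desc[OF assms(2)] desc_length by (auto simp: lineage_def)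
  have "card (gen d n m L) \<le> card (B0 d m \<union> bchs n m L)"
    using fin by (intro card_mono) (auto simp: gen_def bchs_def finite_B0 finite_bch)
  also have "\<dots> \<le> card (B0 d m) + card (bchs n m L)"
    by (rule card_Un_le)
  also have "card (bchs n m L) \<le> (\<Sum>x\<in>L. card (bch n m x))"
    unfolding bchs_def by (rule card_UN_le[OF fin])
  also have "\<dots> \<le> (\<Sum>x\<in>L. (n * m + 1) ^ d)"
    using card_bch_le[OF assms(1), of m] len by (intro sum_mono) metis
  finally show ?thesis
    by (simp add: mult.commute)
qed

theorem theorem9p3:
  fixes d n m :: nat and g :: int
  assumes "d \<ge> 1" and "n \<ge> 2" and "m \<ge> 2" and "g \<ge> 1"
  shows "\<exists>K::real. \<forall>(H :: nat \<Rightarrow> idx set) (M :: nat \<Rightarrow> idx set).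
           H 0 = B0 d m \<and> (\<forall>r. M r \<subseteq> H r \<and> garefine d n m g (H r) (M r) (H (Suc r)))
           \<longrightarrow> (\<forall>R\<ge>1. real (card (H R)) - real (card (H 0))
                        \<le> K * (\<Sum>r<R. real (card (M r))))"
proof -
  define G where "G = nat g"
  have G: "G \<ge> 1" "int G = g" and m: "m \<ge> 1" and n: "n \<ge> 1"
    using assms by (auto simp: G_def)
  \<comment> \<open>\<open>C\<close> bounds the lineage members per marked B-spline,
    \<open>B\<close> the children per lineage member.\<close>
  define C where "C = 2 * real ((2 * (3 * m + 4 * m * n) + 2) ^ d)"
  define B where "B = real ((n * m + 1) ^ d)"
  have "real (card (H R)) - real (card (H 0)) \<le> B * C * (\<Sum>r<R. real (card (M r)))"
    if H: "H 0 = B0 d m \<and> (\<forall>r. M r \<subseteq> H r \<and> garefine d n m g (H r) (M r) (H (Suc r)))" for H M R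
  proof -
    have ex: "\<exists>L P. gen d n m L = H r \<and> marked_inv d n m G L P \<and> P \<subseteq> (\<Union>i<r. M i)" for r
    proof (induction r)
      case 0
      have "gen d n m {} = H 0" "marked_inv d n m G {} {}"
        using H by (auto simp: gen_def bchs_def marked_inv_def lineage_def gap_closed_def cells_def)
      then show ?case by blast
    next
      case (Suc r)
      then obtain L P where L: "gen d n m L = H r" and inv: "marked_inv d n m G L P"
        and P: "P \<subseteq> (\<Union>i<r. M i)"
        by blast
      obtain L0 Lf L' where L0: "lineage d n m L0" "gen d n m L0 = H r"
        and loop: "ga_loop d n m g (M r) L0 Lf" and L': "abs_rel d n m Lf L'" "H (Suc r) = gen d n m L'"
        using H unfolding garefine_def by metis
      \<comment> \<open>\<open>garefine\<close> starts from some lineage of \<open>H r\<close>; a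
        generator determines its lineage, so it is the one carrying the invariant.\<close>
      have "L0 = L"
        using lineage_eqI[OF L0(1)] L0(2) L inv by (auto simp: marked_inv_def)
      then obtain P' where P': "marked_inv d n m G Lf P'" "P' \<subseteq> P \<union> M r"
        using marked_inv_loop[of d n m G "M r" L0 Lf P] loop inv G m assms by auto
      have "P' \<subseteq> (\<Union>i<Suc r. M i)"
        using P P'(2) by (auto simp: lessThan_Suc)
      then show ?case
        using marked_inv_absorb[OF m P'(1) L'(1)] L'(2) by blast
    qed
    \<comment> \<open>An infinite set has \<open>card\<close> 0, so finiteness must be known before
      \<open>card P\<close> can be bounded through the sets \<open>M r\<close>.\<close>
    have "finite (M r)" for r
    proof -
      obtain L P where "gen d n m L = H r" "marked_inv d n m G L P"
        using ex by blast
      then have "finite (H r)"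
        using finite_gen[of L d n m] by (simp add: marked_inv_def lineage_def)
      then show ?thesis
        using H finite_subset by blast
    qed
    then have fin: "finite (\<Union>i<R. M i)"
      by simp
    obtain L P where L: "gen d n m L = H R" and inv: "marked_inv d n m G L P" and P: "P \<subseteq> (\<Union>i<R. M i)"
      using ex by blast
    have "card P \<le> (\<Sum>r<R. card (M r))"
      using card_mono[OF fin P] card_UN_le[of "{..<R}" M] by simp
    then have P_le: "real (card P) \<le> (\<Sum>r<R. real (card (M r)))"
      unfolding of_nat_sum[symmetric] by (rule of_nat_mono)
    have "real (card (H R)) \<le> real (card (H 0)) + B * real (card L)"
      using of_nat_mono[where 'a=real, OF card_gen_le[OF n, of d m L]] L H inv
      by (simp add: B_def marked_inv_def)
    also have "B * real (card L) \<le> B * (C * real (card P))"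
      using card_lineage_le[OF assms(2) m inv] by (intro mult_left_mono) (simp_all add: B_def C_def)
    also have "\<dots> \<le> B * (C * (\<Sum>r<R. real (card (M r))))"
      using P_le by (intro mult_left_mono) (simp_all add: B_def C_def)
    finally show ?thesis
      by (simp add: mult.assoc)
  qed
  then show ?thesis
    by blast
qed

end
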